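(* Let $p$ be a prime and let $k$ be an integer with $1\le k\le p-1$. Let $\mathcal{A}=(a_i)_{i=0}^\infty$ be the sequence over $\mathbb{F}_p$ defined by $$a_i=\binom{i+k}{k}\bmod p,\qquad i=0,1,\ldots,$$ and let $E_p(\mathcal{A})$ be its $p$th expansion complexity. If $(k+1)(k+2)<p$, then $$E_p(\mathcal{A})=k+2,$$ and if $(k+1)(k+2)\ge p$, then $$\left\lceil \frac{p}{k+2}\right\rceil\le E_p(\mathcal{A})\le \max\left\{\left\lceil\frac{p}{k+2}\right\rceil,\ (k+1)\left\{\frac{p}{k+1}\right\}\right\},$$ where inside the maximum $\left\{\frac{p}{k+1}\right\}$ denotes the fractional part of $\frac{p}{k+1}$, that is, $\{x\}=x-\lfloor x\rfloor$.
   Context: $\mathbb{F}_p$ is the field with $p$ elements. For a sequence $\mathcal{S}=(s_i)_{i=0}^\infty$ over a finite field $\mathbb{F}_q$ with generating function $G(x)=\sum_{i=0}^\infty s_ix^i\in\mathbb{F}_q[[x]]$ and a positive integer $N$, the $N$th expansion complexity $E_N(\mathcal{S})$ is defined by $E_N(\mathcal{S})=0$ if $s_0=\cdots=s_{N-1}=0$, and otherwise $E_N(\mathcal{S})$ is the least total degree of a nonzero polynomial $h(x,y)\in\mathbb{F}_q[x,y]$ with $h(x,G(x))\equiv 0\bmod x^N$. Here $q=N=p$. *)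

theory Defs
  imports Complex_Main "HOL-Computational_Algebra.Computational_Algebra"
begin

text \<open>
  A bivariate polynomial \<open>h(x, y)\<close> is represented as a value of type \<open>'a poly poly\<close>: the outer
  variable is \<open>y\<close>, and its coefficients are polynomials in \<open>x\<close>. Thus \<open>coeff (coeff h j) i\<close> is the
  coefficient of the monomial \<open>x^i y^j\<close>.
\<close>

text \<open>Only used for nonzero \<open>h\<close>; for \<open>h = 0\<close> this is the unspecified value \<open>Max {}\<close>.\<close>
definition total_degree :: "'a::zero poly poly \<Rightarrow> nat" where
  "total_degree h = Max {i + j | i j. coeff (coeff h j) i \<noteq> 0}"

definition subst_fps :: "'a::comm_ring_1 poly poly \<Rightarrow> 'a fps \<Rightarrow> 'a fps" where
  "subst_fps h G = poly (map_poly fps_of_poly h) G"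

text \<open>
  The \<open>LEAST\<close> is always attained: \<open>h(x, y) = x^N\<close> satisfies the condition.
\<close>
definition expansion_complexity :: "nat \<Rightarrow> (nat \<Rightarrow> 'a::field) \<Rightarrow> nat" where
  "expansion_complexity N s =
     (if \<forall>i<N. s i = 0 then 0
      else LEAST d. \<exists>h. h \<noteq> 0 \<and> total_degree h = d \<and>
                        fps_X ^ N dvd subst_fps h (Abs_fps s))"

end

theory Submission
  imports Defs "HOL-Number_Theory.Cong"
begin

text \<open>
  Put \<open>m = k + 1\<close> and \<open>t = 1 - x\<close>. Newton's binomial series says that the generating function is
  \<open>G = t^(-m)\<close>, and in characteristic \<open>p\<close> the modulus is \<open>x^p = 1 - t^p\<close>. Total degree is
  unchanged by the affine substitution \<open>x = 1 - t\<close>, so a polynomial \<open>h\<close> may be expanded in the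
  monomials \<open>t^i y^j\<close>, which \<open>y = G\<close> sends to \<open>t^(i - m j)\<close> in \<open>F_p[t]/(t^p - 1)\<close>. This is the
  group algebra of the integers modulo \<open>p\<close>, with the powers of \<open>t\<close> as a basis, so \<open>h\<close> can
  vanish at \<open>G\<close> only if two distinct monomials in it have the same exponent \<open>i - m j\<close> modulo \<open>p\<close>;
  conversely the difference of two such monomials does vanish. Hence the expansion complexity is the
  least degree \<open>d\<close> for which two distinct monomials of degree at most \<open>d\<close> collide
  (\<open>expansion_complexity_le_iff\<close>); no polynomials are left in the problem.

  It remains to find the first collision. If \<open>d (m + 1) < p\<close>, the two exponents can only agree as
  integers, not merely modulo \<open>p\<close>, and such an agreement needs \<open>d \<ge> m + 1\<close>
  (\<open>collision_degree_bound\<close>); this gives both lower bounds. The integer agreement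
  of \<open>t^m y\<close> with \<open>1\<close> has degree \<open>m + 1 = k + 2\<close>. The other collisions used are those of
  \<open>t^(p - m w)\<close> with \<open>y^w\<close>, of degree \<open>max (p - m w) w\<close>: one takes \<open>w = \<lceil>p / (m + 1)\<rceil>\<close> as long as
  \<open>m w \<le> p\<close>, and otherwise \<open>w = \<lfloor>p / m\<rfloor>\<close>, where \<open>p - m w\<close> is the remainder
  \<open>m {p / m}\<close>.
\<close>

section \<open>Total degree and substitution\<close>

lemma finite_monomials: "finite {i + j | i j. coeff (coeff h j) i \<noteq> (0::'a::zero)}"
proof -
  let ?S = "SIGMA j:{..degree h}. {..degree (coeff h j)}"
  have "{i + j | i j. coeff (coeff h j) i \<noteq> 0} \<subseteq> (\<lambda>(j, i). i + j) ` ?S"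
  proof clarify
    fix i j
    assume "coeff (coeff h j) i \<noteq> 0"
    moreover from this have "coeff h j \<noteq> 0" by auto
    ultimately have "(j, i) \<in> ?S" by (auto intro: le_degree)
    then show "i + j \<in> (\<lambda>(j, i). i + j) ` ?S" by (intro image_eqI[of _ _ "(j, i)"]) auto
  qed
  then show ?thesis by (rule finite_subset) auto
qed

lemma total_degree_ge: "coeff (coeff h j) i \<noteq> 0 \<Longrightarrow> i + j \<le> total_degree h"
  unfolding total_degree_def by (rule Max_ge[OF finite_monomials]) auto

lemma total_degree_le:
  assumes "h \<noteq> 0" and "\<And>i j. coeff (coeff h j) i \<noteq> 0 \<Longrightarrow> i + j \<le> d"
  shows "total_degree h \<le> d"
proof -
  have "coeff (coeff h (degree h)) (degree (coeff h (degree h))) \<noteq> 0"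
    using assms(1) by simp
  then have "{i + j | i j. coeff (coeff h j) i \<noteq> 0} \<noteq> {}" by blast
  then show ?thesis
    unfolding total_degree_def using assms(2) by (subst Max_le_iff[OF finite_monomials]) auto
qed

lemma subst_fps_eq_sum:
  assumes "degree h \<le> D"
  shows "subst_fps h G = (\<Sum>j\<le>D. fps_of_poly (coeff h j) * G ^ j)"
proof -
  have "subst_fps h G = (\<Sum>j\<le>degree h. fps_of_poly (coeff h j) * G ^ j)"
    unfolding subst_fps_def by (subst poly_altdef) (simp add: degree_map_poly coeff_map_poly)
  also have "\<dots> = (\<Sum>j\<le>D. fps_of_poly (coeff h j) * G ^ j)"
    using assms by (intro sum.mono_neutral_left) (auto simp: coeff_eq_0)
  finally show ?thesis .
qed

lemma fps_of_poly_one_minus_X: "fps_of_poly [:1, -1:] = (1 - fps_X :: 'a::comm_ring_1 fps)"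
  by (rule fps_ext) (simp add: fps_of_poly_nth coeff_pCons fps_X_def split: nat.split)

lemma pcompose_monom: "pcompose (monom c n) q = smult c (q ^ n)"
  by (induction n) (simp_all add: monom_0 monom_Suc pcompose_pCons)

text \<open>Rewriting in powers of \<open>1 - x\<close> is an affine change of variable, hence keeps the degree.\<close>

lemma fps_of_poly_in_powers_of_one_minus_X:
  fixes q :: "'a::field poly"
  assumes "degree q \<le> n"
  shows "fps_of_poly q = (\<Sum>i\<le>n. fps_const (coeff (pcompose q [:1, -1:]) i) * (1 - fps_X) ^ i)"
proof -
  let ?g = "pcompose q [:1, -1:]"
  have "degree ?g \<le> n" using assms by (simp add: degree_pcompose)
  have "q = pcompose ?g [:1, -1:]"
    by (simp add: pcompose_assoc [symmetric] pcompose_pCons)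
  also have "\<dots> = (\<Sum>i\<le>degree ?g. smult (coeff ?g i) ([:1, -1:] ^ i))"
    by (subst pcompose_altdef, subst poly_altdef) (simp add: degree_map_poly coeff_map_poly)
  also have "\<dots> = (\<Sum>i\<le>n. smult (coeff ?g i) ([:1, -1:] ^ i))"
    using \<open>degree ?g \<le> n\<close> by (intro sum.mono_neutral_left) (auto simp: coeff_eq_0)
  finally have "fps_of_poly q = fps_of_poly (\<Sum>i\<le>n. smult (coeff ?g i) ([:1, -1:] ^ i))" by simp
  also have "\<dots> = (\<Sum>i\<le>n. fps_const (coeff ?g i) * (1 - fps_X) ^ i)"
    by (simp only: fps_of_poly_sum fps_of_poly_smult fps_of_poly_power fps_of_poly_one_minus_X)
  finally show ?thesis .
qed

section \<open>Powers of \<open>1 - x\<close> modulo \<open>x^p\<close>\<close>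

text \<open>
  Writing \<open>A k\<close> for the series, the recursion \<open>(1 - x) A (k + 1) = A k\<close> is Pascal's rule.
\<close>

lemma fps_binomial_series_mult_one_minus_X_power:
  "Abs_fps (\<lambda>i. of_nat ((i + k) choose k)) * (1 - fps_X) ^ (k + 1) = (1 :: 'a::comm_ring_1 fps)"
proof (induction k)
  case 0
  show ?case by (rule fps_ext) (auto simp: algebra_simps fps_X_mult_nth)
next
  case (Suc k)
  have "Abs_fps (\<lambda>i. of_nat ((i + Suc k) choose Suc k)) * (1 - fps_X)
      = (Abs_fps (\<lambda>i. of_nat ((i + k) choose k)) :: 'a fps)"
  proof (rule fps_ext)
    fix n
    show "(Abs_fps (\<lambda>i. of_nat ((i + Suc k) choose Suc k)) * (1 - fps_X)) $ n
        = (Abs_fps (\<lambda>i. of_nat ((i + k) choose k)) :: 'a fps) $ n"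
      by (cases n) (simp_all add: algebra_simps binomial_eq_0)
  qed
  with Suc.IH show ?case by (simp add: mult.assoc [symmetric])
qed

context
  fixes p :: nat
  assumes p: "prime p" and char: "CHAR('a::field) = p"
begin

lemma one_minus_X_power_char: "(1 - fps_X :: 'a fps) ^ p = 1 - fps_X ^ p"
proof -
  have "(fps_X + (1 - fps_X) :: 'a fps) ^ p = fps_X ^ p + (1 - fps_X) ^ p"
    by (rule freshmans_dream) (simp_all add: p char)
  then show ?thesis by (simp add: algebra_simps)
qed

lemma one_minus_X_power_mod_char:
  "fps_X ^ p dvd (1 - fps_X :: 'a fps) ^ n - (1 - fps_X) ^ (n mod p)"
proof -
  have "(1 - fps_X :: 'a fps) ^ n = ((1 - fps_X) ^ p) ^ (n div p) * (1 - fps_X) ^ (n mod p)"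
    by (simp flip: power_mult power_add)
  then have "(1 - fps_X :: 'a fps) ^ n - (1 - fps_X) ^ (n mod p)
      = ((1 - fps_X ^ p) ^ (n div p) - 1) * (1 - fps_X) ^ (n mod p)"
    by (simp add: one_minus_X_power_char algebra_simps)
  moreover have "fps_X ^ p dvd (1 - fps_X ^ p :: 'a fps) ^ (n div p) - 1"
  proof -
    have "(1 - fps_X ^ p) - 1 dvd (1 - fps_X ^ p :: 'a fps) ^ (n div p) - 1"
      by (subst power_diff_1_eq) simp
    then show ?thesis by simp
  qed
  ultimately show ?thesis by (metis dvd_mult2)
qed

lemma one_minus_X_power_cong:
  assumes "[n = n'] (mod p)"
  shows "fps_X ^ p dvd (1 - fps_X :: 'a fps) ^ n - (1 - fps_X) ^ n'"
  using dvd_diff[OF one_minus_X_power_mod_char[of n] one_minus_X_power_mod_char[of n']] assms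
  by (simp add: cong_def)

text \<open>
  After reduction of the exponents modulo \<open>p\<close>, the sum is a polynomial in \<open>1 - x\<close> of degree below
  \<open>p\<close>, so divisibility by \<open>x^p\<close> forces it to be zero; its coefficients are the \<open>c s\<close> because no
  two exponents coincide.
\<close>

lemma one_minus_X_powers_independent:
  fixes c :: "'s \<Rightarrow> 'a"
  assumes "finite T" and inj: "inj_on (\<lambda>s. e s mod p) T"
    and dvd: "fps_X ^ p dvd (\<Sum>s\<in>T. fps_const (c s) * (1 - fps_X) ^ e s)"
    and "s \<in> T"
  shows "c s = 0"
proof -
  define P where "P = (\<Sum>s\<in>T. monom (c s) (e s mod p))"
  define Q where "Q = pcompose P [:1, -1:]"
  have "degree P < p"
    unfolding P_def using prime_gt_0_nat[OF p]
    by (intro degree_sum_less le_less_trans[OF degree_monom_le]) auto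
  then have "degree Q < p" by (simp add: Q_def degree_pcompose)
  have "fps_of_poly Q = (\<Sum>s\<in>T. fps_const (c s) * (1 - fps_X) ^ (e s mod p))"
    by (simp only: Q_def P_def pcompose_sum pcompose_monom fps_of_poly_sum fps_of_poly_smult
        fps_of_poly_power fps_of_poly_one_minus_X)
  also have "\<dots> = (\<Sum>s\<in>T. fps_const (c s) * (1 - fps_X) ^ e s)
      - (\<Sum>s\<in>T. fps_const (c s) * ((1 - fps_X) ^ e s - (1 - fps_X) ^ (e s mod p)))"
    by (simp add: sum_subtractf [symmetric] algebra_simps)
  also have "fps_X ^ p dvd \<dots>"
    by (intro dvd_diff dvd dvd_sum dvd_mult one_minus_X_power_mod_char)
  finally obtain R where R: "fps_of_poly Q = fps_X ^ p * R" by (rule dvdE)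
  have "coeff Q n = 0" for n
  proof (cases "n < p")
    case True
    have "coeff Q n = fps_of_poly Q $ n" by simp
    also have "\<dots> = 0" using True unfolding R by (simp add: fps_X_power_mult_nth)
    finally show ?thesis .
  next
    case False
    with \<open>degree Q < p\<close> show ?thesis by (simp add: coeff_eq_0)
  qed
  then have "Q = 0" by (simp add: poly_eq_iff)
  then have "P = 0" unfolding Q_def by (rule pcompose_eq_0) simp
  then have "0 = coeff P (e s mod p)" by simp
  also have "\<dots> = (\<Sum>s'\<in>T. if s' = s then c s' else 0)"
    unfolding P_def coeff_sum using inj \<open>s \<in> T\<close>
    by (intro sum.cong) (auto dest: inj_onD)
  also have "\<dots> = c s" using \<open>finite T\<close> \<open>s \<in> T\<close> by simp
  finally show ?thesis by simp
qed

end

section \<open>Expansion complexity as the first collision of monomials\<close>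

text \<open>
  The condition says that \<open>i - m j\<close> and \<open>i' - m j'\<close> agree modulo \<open>p\<close>, rearranged to avoid
  subtraction: the monomials \<open>t^i y^j\<close> and \<open>t^i' y^j'\<close> have the same image in
  \<open>F_p[t]/(t^p - 1)\<close> under \<open>y = t^(-m)\<close>.
\<close>

definition collision :: "nat \<Rightarrow> nat \<Rightarrow> nat \<Rightarrow> bool" where
  "collision p m d \<longleftrightarrow> (\<exists>i j i' j'. (i, j) \<noteq> (i', j') \<and> i + j \<le> d \<and> i' + j' \<le> d \<and>
      [i + m * j' = i' + m * j] (mod p))"

lemma collisionI:
  assumes "(i, j) \<noteq> (i', j')" "i + j \<le> d" "i' + j' \<le> d" "[i + m * j' = i' + m * j] (mod p)"
  shows "collision p m d"
  unfolding collision_def using assms by blast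

lemma collision_mono: "collision p m d \<Longrightarrow> d \<le> d' \<Longrightarrow> collision p m d'"
  unfolding collision_def by (meson le_trans)

context
  fixes p m :: nat and G :: "'a::field fps"
  assumes p: "prime p" and char: "CHAR('a) = p" and G: "G * (1 - fps_X) ^ m = 1"
begin

lemma one_minus_X_power_mult_G_power:
  "(1 - fps_X) ^ (m * j + n) * G ^ j = (1 - fps_X) ^ n"
proof -
  have "(1 - fps_X) ^ (m * j + n) * G ^ j = (G * (1 - fps_X) ^ m) ^ j * (1 - fps_X) ^ n"
    unfolding power_add power_mult power_mult_distrib by (simp only: mult_ac)
  then show ?thesis by (simp add: G)
qed

text \<open>
  Multiplying by the unit \<open>t^(m d)\<close> clears the negative exponents; without a collision the
  exponents \<open>i + m (d - j)\<close> are distinct modulo \<open>p\<close>, and all coefficients of \<open>h\<close> must vanish.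
\<close>

lemma annihilator_gives_collision:
  assumes "h \<noteq> 0" and dvd: "fps_X ^ p dvd subst_fps h G"
  shows "collision p m (total_degree h)"
proof (rule ccontr)
  assume no_coll: "\<not> collision p m (total_degree h)"
  define d where "d = total_degree h"
  define g where "g = (\<lambda>j. pcompose (coeff h j) [:1, -1:])"
  define T where "T = (SIGMA j:{..d}. {..d - j})"
  define e where "e = (\<lambda>(j, i). i + m * (d - j))"
  have md: "m * d = m * j + m * (d - j)" if "j \<le> d" for j
    using that by (metis add_mult_distrib2 le_add_diff_inverse)
  have deg_inner: "degree (coeff h j) \<le> d - j" for j
    using total_degree_ge[of h j] unfolding d_def
    by (intro degree_le allI impI) (metis le_diff_conv leD le_add_diff_inverse2 add.commute
        add_le_imp_le_diff)
  have "coeff h j = 0" if "j > d" for j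
    using total_degree_ge[of h j] that unfolding d_def
    by (intro poly_eqI) (metis add_leD2 coeff_0 leD)
  then have "degree h \<le> d" by (intro degree_le) auto
  have "(1 - fps_X) ^ (m * d) * subst_fps h G
      = (\<Sum>j\<le>d. \<Sum>i\<le>d - j. fps_const (coeff (g j) i) * (1 - fps_X) ^ (i + m * (d - j)))"
  proof -
    have "(1 - fps_X) ^ (m * d) * (fps_of_poly (coeff h j) * G ^ j)
        = (\<Sum>i\<le>d - j. fps_const (coeff (g j) i) * (1 - fps_X) ^ (i + m * (d - j)))"
      if "j \<le> d" for j
    proof -
      have "(1 - fps_X) ^ (m * d) * G ^ j = (1 - fps_X) ^ (m * (d - j))"
        by (simp only: md[OF that] one_minus_X_power_mult_G_power)
      then have "(1 - fps_X) ^ (m * d) * (fps_of_poly (coeff h j) * G ^ j)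
          = (1 - fps_X) ^ (m * (d - j)) * fps_of_poly (coeff h j)"
        by (simp add: mult_ac)
      also have "\<dots> = (1 - fps_X) ^ (m * (d - j)) *
          (\<Sum>i\<le>d - j. fps_const (coeff (g j) i) * (1 - fps_X) ^ i)"
        unfolding g_def by (subst fps_of_poly_in_powers_of_one_minus_X[OF deg_inner]) simp
      finally show ?thesis by (simp add: sum_distrib_left power_add mult_ac)
    qed
    then show ?thesis
      unfolding subst_fps_eq_sum[OF \<open>degree h \<le> d\<close>] sum_distrib_left by (intro sum.cong) auto
  qed
  also have "\<dots> = (\<Sum>s\<in>T. fps_const (case s of (j, i) \<Rightarrow> coeff (g j) i) * (1 - fps_X) ^ e s)"
    unfolding T_def e_def by (subst sum.Sigma) (auto intro!: sum.cong)
  finally have dvd_T: "fps_X ^ p dvd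
      (\<Sum>s\<in>T. fps_const (case s of (j, i) \<Rightarrow> coeff (g j) i) * (1 - fps_X) ^ e s)"
    using dvd by (metis dvd_mult)
  have inj: "inj_on (\<lambda>s. e s mod p) T"
  proof (rule inj_onI, clarify)
    fix j i j' i'
    assume T: "(j, i) \<in> T" "(j', i') \<in> T" and eq: "e (j, i) mod p = e (j', i') mod p"
    have "[i + m * (d - j) + m * (j + j') = i' + m * (d - j') + m * (j + j')] (mod p)"
      using eq by (intro cong_add[OF _ cong_refl]) (simp only: cong_def e_def split)
    moreover have "i + m * (d - j) + m * (j + j') = (i + m * j') + m * d"
      using T md[of j] by (simp add: T_def add_mult_distrib2)
    moreover have "i' + m * (d - j') + m * (j + j') = (i' + m * j) + m * d"
      using T md[of j'] by (simp add: T_def add_mult_distrib2)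
    ultimately have "[i + m * j' = i' + m * j] (mod p)"
      by (simp only: cong_add_rcancel_nat)
    moreover have "i + j \<le> d" "i' + j' \<le> d" using T by (auto simp: T_def)
    ultimately show "j = j' \<and> i = i'"
      using collisionI[of i j i' j' d m p] no_coll unfolding d_def by auto
  qed
  have "g j = 0" for j
  proof (rule poly_eqI)
    fix i
    show "coeff (g j) i = coeff 0 i"
    proof (cases "(j, i) \<in> T")
      case True
      have "finite T" by (simp add: T_def)
      from one_minus_X_powers_independent[OF p char this inj dvd_T True] show ?thesis by simp
    next
      case False
      then have "j > d \<or> i > d - j" by (auto simp: T_def)
      moreover have "degree (g j) \<le> d - j" using deg_inner by (simp add: g_def degree_pcompose)
      ultimately show ?thesis
        using \<open>\<And>j. j > d \<Longrightarrow> coeff h j = 0\<close> by (auto simp: g_def coeff_eq_0)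
    qed
  qed
  then have "coeff h j = 0" for j
    unfolding g_def by (rule pcompose_eq_0) simp
  with \<open>h \<noteq> 0\<close> show False by (simp add: poly_eq_iff)
qed

text \<open>
  The difference of the two monomials, with \<open>t = 1 - x\<close> substituted, is an annihilator: it becomes
  a difference of powers of \<open>t\<close> with congruent exponents once the unit \<open>G^(j + j')\<close> is factored out.
\<close>

lemma collision_gives_annihilator:
  assumes "collision p m d"
  shows "\<exists>h. h \<noteq> 0 \<and> total_degree h \<le> d \<and> fps_X ^ p dvd subst_fps h G"
proof -
  from assms obtain i j i' j' where neq: "(i, j) \<noteq> (i', j')"
    and le: "i + j \<le> d" "i' + j' \<le> d" and cong: "[i + m * j' = i' + m * j] (mod p)"
    unfolding collision_def by blast
  define t :: "'a poly" where "t = [:1, -1:]"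
  have deg_t: "degree (t ^ n) = n" for n by (simp add: t_def degree_power_eq)
  have "t \<noteq> 0" by (simp add: t_def)
  define h where "h = monom (t ^ i) j - monom (t ^ i') j'"
  have "h \<noteq> 0"
  proof (cases "j = j'")
    case True
    with neq have "t ^ i \<noteq> t ^ i'" by (metis deg_t)
    with True show ?thesis by (simp add: h_def diff_monom)
  next
    case False
    then have "coeff h j = t ^ i" by (simp add: h_def)
    with \<open>t \<noteq> 0\<close> show ?thesis by auto
  qed
  moreover have "total_degree h \<le> d"
  proof (rule total_degree_le[OF \<open>h \<noteq> 0\<close>])
    fix n l
    assume "coeff (coeff h l) n \<noteq> 0"
    then have "l = j \<and> coeff (t ^ i) n \<noteq> 0 \<or> l = j' \<and> coeff (t ^ i') n \<noteq> 0"
      by (auto simp: h_def split: if_splits)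
    then have "l = j \<and> n \<le> i \<or> l = j' \<and> n \<le> i'"
      using le_degree deg_t by metis
    with le show "n + l \<le> d" by auto
  qed
  moreover have "fps_X ^ p dvd subst_fps h G"
  proof -
    have fps_t: "fps_of_poly (t ^ n) = (1 - fps_X) ^ n" for n
      by (simp only: t_def fps_of_poly_power fps_of_poly_one_minus_X)
    have "degree h \<le> max j j'"
      unfolding h_def by (intro degree_diff_le le_trans[OF degree_monom_le]) auto
    then have "subst_fps h G = (1 - fps_X) ^ i * G ^ j - (1 - fps_X) ^ i' * G ^ j'"
      by (simp add: subst_fps_eq_sum h_def fps_of_poly_diff algebra_simps sum_subtractf
          if_distrib[of fps_of_poly] if_distrib[of "\<lambda>x. x * _"] if_distrib[of "\<lambda>x. _ * x"]
          fps_t sum.delta cong: if_cong)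
    also have "\<dots> = ((1 - fps_X) ^ (i + m * j') - (1 - fps_X) ^ (i' + m * j)) * (G ^ j * G ^ j')"
      using one_minus_X_power_mult_G_power[of j i'] one_minus_X_power_mult_G_power[of j' i]
      by (simp add: algebra_simps)
    finally show ?thesis using one_minus_X_power_cong[OF p char cong] by simp
  qed
  ultimately show ?thesis by blast
qed

theorem expansion_complexity_le_iff:
  assumes s: "Abs_fps s = G"
  shows "expansion_complexity p s \<le> d \<longleftrightarrow> collision p m d"
proof -
  let ?Q = "\<lambda>d. \<exists>h. h \<noteq> 0 \<and> total_degree h = d \<and> fps_X ^ p dvd subst_fps h G"
  have "s 0 \<noteq> 0"
  proof
    assume "s 0 = 0"
    then have "G $ 0 = 0" by (simp flip: s)
    then have "(G * (1 - fps_X) ^ m) $ 0 = 0" by simp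
    with G show False by simp
  qed
  then have E: "expansion_complexity p s = (LEAST d. ?Q d)"
    using prime_gt_0_nat[OF p] by (auto simp: expansion_complexity_def s)
  show ?thesis
  proof
    assume "collision p m d"
    from collision_gives_annihilator[OF this] obtain d' where "?Q d'" "d' \<le> d" by blast
    from Least_le[of ?Q, OF this(1)] this(2) show "expansion_complexity p s \<le> d"
      unfolding E by (rule le_trans)
  next
    assume le: "expansion_complexity p s \<le> d"
    (* The monomials 1 and t^p collide, so the minimum is over a nonempty set. *)
    have "collision p m p"
      by (rule collisionI[of 0 0 p 0]) (use prime_gt_0_nat[OF p] in \<open>auto simp: cong_def\<close>)
    from collision_gives_annihilator[OF this] have "\<exists>d. ?Q d" by blast
    then have "?Q (expansion_complexity p s)" unfolding E by (rule LeastI_ex)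
    then have "collision p m (expansion_complexity p s)"
      using annihilator_gives_collision by metis
    from collision_mono[OF this le] show "collision p m d" .
  qed
qed

end

section \<open>The degree of the first collision\<close>

lemma collision_degree_bound:
  assumes "collision p m d"
  shows "p \<le> d * (m + 1) \<or> m + 1 \<le> d"
proof (rule disj_imp[THEN iffD2], rule impI)
  assume small: "\<not> p \<le> d * (m + 1)"
  from assms obtain i j i' j' where neq: "(i, j) \<noteq> (i', j')"
    and le: "i + j \<le> d" "i' + j' \<le> d" and cong: "[i + m * j' = i' + m * j] (mod p)"
    unfolding collision_def by blast
  have below: "a + m * b < p" if "a \<le> d" "b \<le> d" for a b
    using small add_le_mono[OF that(1) mult_le_mono2[OF that(2), of m]]
    by (simp add: algebra_simps)
  have eq: "i + m * j' = i' + m * j"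
    using cong_less_modulus_unique_nat[OF cong] below le by simp
  (* Given that the exponents agree as integers, each extra factor y costs m extra factors t. *)
  have step: "m + 1 \<le> x + y" if "x + m * y' = x' + m * y" "y' < y" for x y x' y' :: nat
  proof -
    have "m * (y' + 1) \<le> m * y" using that(2) by (intro mult_le_mono2) simp
    with that show ?thesis by simp
  qed
  consider "j' < j" | "j < j'" | "j = j'" by linarith
  then show "m + 1 \<le> d"
  proof cases
    case 1
    from step[OF eq 1] le show ?thesis by simp
  next
    case 2
    from step[OF eq[symmetric] 2] le show ?thesis by simp
  next
    case 3
    with eq neq show ?thesis by simp
  qed
qed

text \<open>
  The hypothesis on \<open>w\<close>, whose least solution is \<open>\<lceil>p / (m + 1)\<rceil>\<close>, says that the exponent
  \<open>p - m w\<close> of \<open>t\<close> in the collision with \<open>y^w\<close> is at most \<open>w\<close>. If it is negative, then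
  \<open>\<lfloor>p / m\<rfloor> \<le> w\<close>, and the collision given by \<open>p = m \<lfloor>p / m\<rfloor> + p mod m\<close> is good enough.
\<close>

lemma collision_at_quotient:
  assumes "p > 0" and w: "p \<le> w * (m + 1)"
  shows "collision p m (max w (p mod m))"
proof (cases "m * w \<le> p")
  case True
  show ?thesis
  proof (rule collisionI[of "p - m * w" 0 0 w])
    show "(p - m * w, 0) \<noteq> (0, w)" using assms by (cases w) auto
    show "[p - m * w + m * w = 0 + m * 0] (mod p)" using True by (simp add: cong_def)
  qed (use w in \<open>auto simp: algebra_simps\<close>)
next
  case False
  then have "p div m \<le> w" by (simp add: div_le_mono less_imp_le less_mult_imp_div_less mult.commute)
  show ?thesis
  proof (rule collisionI[of "p mod m" 0 0 "p div m"])
    show "(p mod m, 0) \<noteq> (0, p div m)" using \<open>p > 0\<close> by (metis Pair_inject div_mod_decomp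
      mult_zero_left add_0 less_irrefl)
    show "[p mod m + m * (p div m) = 0 + m * 0] (mod p)" by (simp add: cong_def)
  qed (use \<open>p div m \<le> w\<close> in auto)
qed

lemma collision_at_Suc: "collision p m (m + 1)"
  by (rule collisionI[of m 1 0 0]) (auto simp: cong_def)

lemma CHAR_eq_prime_card:
  assumes "prime p" and "card (UNIV :: 'a :: {field, finite} set) = p"
  shows "CHAR('a) = p"
proof -
  (* Translation by 1 permutes the field, so it leaves the sum of all elements unchanged. *)
  have "(\<Sum>x\<in>(UNIV :: 'a set). x + 1) = \<Sum>UNIV"
    by (rule sum.reindex_bij_witness[of _ "\<lambda>x. x - 1" "\<lambda>x. x + 1"]) auto
  then have "of_nat p = (0 :: 'a)" using assms(2) by (simp add: sum.distrib)
  then have "CHAR('a) dvd p" by (simp add: of_nat_eq_0_iff_char_dvd)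
  then show ?thesis using \<open>prime p\<close> CHAR_not_1'[where 'a='a] by (auto simp: prime_nat_iff)
qed

theorem theorem2:
  fixes p k :: nat and a :: "nat \<Rightarrow> 'a :: {field, finite}"
  assumes "prime p" and "card (UNIV :: 'a set) = p"
    and "1 \<le> k" and "k \<le> p - 1"
    and "\<And>i. a i = of_nat ((i + k) choose k)"
  shows "((k + 1) * (k + 2) < p \<longrightarrow> expansion_complexity p a = k + 2) \<and>
         ((k + 1) * (k + 2) \<ge> p \<longrightarrow>
            real_of_int \<lceil>real p / real (k + 2)\<rceil> \<le> real (expansion_complexity p a) \<and>
            real (expansion_complexity p a) \<le>
              max (real_of_int \<lceil>real p / real (k + 2)\<rceil>)
                  (real (k + 1) * frac (real p / real (k + 1))))"
proof -
  define E where "E = expansion_complexity p a"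
  have "a = (\<lambda>i. of_nat ((i + k) choose k))" using assms(5) by blast
  then have "Abs_fps a * (1 - fps_X) ^ (k + 1) = 1"
    by (simp only: fps_binomial_series_mult_one_minus_X_power)
  from expansion_complexity_le_iff[OF assms(1) CHAR_eq_prime_card[OF assms(1,2)] this refl]
  have E_le_iff: "E \<le> d \<longleftrightarrow> collision p (k + 1) d" for d
    unfolding E_def .
  have lower: "p \<le> E * (k + 2) \<or> k + 2 \<le> E"
    using collision_degree_bound[of p "k + 1" E] E_le_iff[of E] by simp
  have "E = k + 2" if "(k + 1) * (k + 2) < p"
  proof (rule antisym)
    show "E \<le> k + 2" using collision_at_Suc[of p "k + 1"] E_le_iff by simp
    show "k + 2 \<le> E"
    proof (rule ccontr)
      assume "\<not> k + 2 \<le> E"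
      then have "E * (k + 2) \<le> (k + 1) * (k + 2)" by (intro mult_le_mono1) simp
      with that lower \<open>\<not> k + 2 \<le> E\<close> show False by simp
    qed
  qed
  moreover have "real_of_int \<lceil>real p / real (k + 2)\<rceil> \<le> real E \<and>
      real E \<le> max (real_of_int \<lceil>real p / real (k + 2)\<rceil>)
                  (real (k + 1) * frac (real p / real (k + 1)))"
    if large: "p \<le> (k + 1) * (k + 2)"
  proof
    have "p \<le> E * (k + 2)"
      using lower
    proof
      assume "k + 2 \<le> E"
      then have "(k + 1) * (k + 2) \<le> E * (k + 2)" by (intro mult_le_mono1) simp
      with large show ?thesis by simp
    qed
    then have "real p \<le> real E * real (k + 2)" by (simp only: flip: of_nat_mult of_nat_le_iff)
    then have "real p / real (k + 2) \<le> of_int (int E)" by (simp add: divide_le_eq)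
    then have "\<lceil>real p / real (k + 2)\<rceil> \<le> int E" by (rule ceiling_le)
    then show "real_of_int \<lceil>real p / real (k + 2)\<rceil> \<le> real E" by linarith
  next
    define w where "w = nat \<lceil>real p / real (k + 2)\<rceil>"
    have w: "real w = real_of_int \<lceil>real p / real (k + 2)\<rceil>" unfolding w_def by simp
    have "real p / real (k + 2) \<le> real w" unfolding w by (rule le_of_int_ceiling)
    then have "real p \<le> real w * real (k + 2)" by (simp add: divide_le_eq)
    then have "real p \<le> real (w * (k + 2))" by (simp only: of_nat_mult)
    then have "p \<le> w * (k + 1 + 1)" by (simp only: of_nat_le_iff) simp
    then have "E \<le> max w (p mod (k + 1))"
      unfolding E_le_iff using prime_gt_0_nat[OF assms(1)] by (rule collision_at_quotient[rotated])
    then have "real E \<le> max (real w) (real (p mod (k + 1)))" by linarith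
    moreover have "real (p mod (k + 1)) = real (k + 1) * frac (real p / real (k + 1))"
    proof -
      have "p = (k + 1) * (p div (k + 1)) + p mod (k + 1)"
        by (rule mult_div_mod_eq[symmetric])
      then have "real p = real (k + 1) * real (p div (k + 1)) + real (p mod (k + 1))"
        by (simp only: flip: of_nat_mult of_nat_add)
      moreover have "real p / real (k + 1)
          = real_of_int \<lfloor>real p / real (k + 1)\<rfloor> + frac (real p / real (k + 1))"
        by (simp add: frac_def)
      moreover have "\<lfloor>real p / real (k + 1)\<rfloor> = int (p div (k + 1))"
        by (rule floor_divide_of_nat_eq)
      ultimately show ?thesis by (simp add: field_simps)
    qed
    ultimately show "real E \<le> max (real_of_int \<lceil>real p / real (k + 2)\<rceil>)
        (real (k + 1) * frac (real p / real (k + 1)))" by (simp only: w)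
  qed
  ultimately show ?thesis unfolding E_def by blast
qed

end
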